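(* Let $s$ be an even positive integer and let $p>3s+1$ be a prime. Then $$\sum_{j=1}^{p-1}\frac{(H_j^{(s)})^2}{j^{s}}\equiv \left[\binom{3s+1}{s-1}+\frac{s}{2}\right]p\,\frac{B_{p-3s-1}}{3s+1}\pmod{p^2}.$$
   Context: For positive integers $s$ and $n\ge 0$, $H_n^{(s)}=\sum_{k=1}^{n}\frac{1}{k^s}$. $(B_n)_{n\ge 0}$ is the sequence of Bernoulli numbers. Congruences modulo $p^2$ are between rational numbers whose denominators are prime to $p$. *)

theory Defs
  imports Complex_Main "HOL-Computational_Algebra.Primes"
begin

definition gen_harmonic :: "nat \<Rightarrow> nat \<Rightarrow> rat" where
  "gen_harmonic s n = (\<Sum>k=1..n. 1 / of_nat k ^ s)"

text \<open>
  Bernoulli numbers, with the convention \<open>B\<^sub>1 = -1/2\<close>: the recurrence is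
  \<open>(\<Sum>k\<le>n. (n + 1 choose k) * B\<^sub>k) = 0\<close> for \<open>n \<ge> 1\<close>, solved for the last term.
\<close>

fun bernoulli :: "nat \<Rightarrow> rat" where
  "bernoulli 0 = 1"
| "bernoulli (Suc n) =
     - (\<Sum>k\<le>n. of_nat ((n + 2) choose k) * bernoulli k) / of_nat (n + 2)"

declare bernoulli.simps [simp del]

lemma bernoulli_1: "bernoulli 1 = - 1 / 2"
  by (simp add: bernoulli.simps)

lemma bernoulli_2: "bernoulli 2 = 1 / 6"
  by (simp add: bernoulli.simps numeral_2_eq_2)

definition denom_coprime :: "nat \<Rightarrow> rat \<Rightarrow> bool" where
  "denom_coprime m x \<longleftrightarrow> coprime (snd (quotient_of x)) (int m)"

text \<open>
  Congruence modulo \<open>m\<close> of rationals with denominators prime to \<open>m\<close>. For \<open>m = p\<^sup>2\<close> with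
  \<open>p\<close> prime, this means denominators prime to \<open>p\<close>. Both sides are required to satisfy this
  condition, so the relation never holds for other rationals.
\<close>

definition rat_cong :: "rat \<Rightarrow> rat \<Rightarrow> nat \<Rightarrow> bool" where
  "rat_cong x y m \<longleftrightarrow> denom_coprime m x \<and> denom_coprime m y \<and>
     (\<exists>z. denom_coprime m z \<and> x - y = of_nat m * z)"

end

theory Submission
  imports Defs "HOL-Number_Theory.Residue_Primitive_Roots"
begin

text \<open>
  Write \<open>a\<^sub>j = 1/j\<^sup>s\<close> and \<open>H\<^sub>j = a\<^sub>1 + \<dots> + a\<^sub>j\<close>. Summation by parts gives, for any sequence \<open>a\<close>,
  \<open>3 \<Sum> (H\<^sub>j)\<^sup>2 a\<^sub>j = 3 \<Sum>\<^bsub>i<j\<^esub> a\<^sub>i a\<^sub>j\<^sup>2 + 2 \<Sum> a\<^sub>j\<^sup>3 + (\<Sum> a\<^sub>j)\<^sup>3\<close>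
  (\<open>sum_partial_sums_squared_mult\<close>). Since \<open>p - 1\<close> does not divide \<open>s\<close>, the last sum is divisible
  by \<open>p\<close> and its cube drops out. What is left is a double sum and a power sum, both of total weight
  \<open>3s\<close>, which have to be evaluated modulo \<open>p\<^sup>2\<close> in the ring of \<open>p\<close>-integral rationals.

  The power sum \<open>\<Sum> 1/j\<^sup>m\<close> has exponent \<open>-m\<close>, congruent to \<open>p - 1 - m\<close> modulo \<open>p - 1\<close>. For the
  positive exponent \<open>n = p - 1 - m\<close>, Faulhaber's formula gives \<open>p B\<^sub>n\<close> modulo \<open>p\<^sup>2\<close>. Multiplication by
  a fixed \<open>a\<close> permutes the residues modulo \<open>p\<close>; expanding \<open>(a j)\<^sup>e\<close> to first order around the residue
  of \<open>a j\<close> yields Voronoi's congruence, which says that modulo \<open>p\<^sup>2\<close> the power sum divided by its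
  exponent depends only on the exponent modulo \<open>p - 1\<close> (\<open>power_sum_ratio\<close>). This replaces Kummer's
  congruence and gives \<open>m/(m+1) p B\<^bsub>p-1-m\<^esub>\<close> (\<open>power_sum_neg\<close>).

  For the double sum \<open>D(a, b) = \<Sum>\<^bsub>i<j\<^esub> i\<^bsup>-a\<^esup> j\<^bsup>-b\<^esup>\<close> with \<open>a\<close> and \<open>b\<close> even, the substitution
  \<open>i \<mapsto> p - i\<close>, \<open>j \<mapsto> p - j\<close> reverses the order of the two indices, so
  \<open>D(a, b) \<equiv> D(b, a) + p (a D(b, a + 1) + b D(b + 1, a))\<close> (\<open>double_sum_reflect\<close>), while
  \<open>D(a, b) + D(b, a)\<close> is a product of power sums minus a power sum (\<open>double_sum_stuffle\<close>).
  Together they determine \<open>D(a, b)\<close> modulo \<open>p\<^sup>2\<close> from power sums and from double sums of odd weight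
  modulo \<open>p\<close>; the latter are multiples of a single Bernoulli number, again by Faulhaber's formula
  (\<open>double_sum_pcong_bernoulli\<close>). Every term is now a multiple of \<open>p B\<^bsub>p-1-3s\<^esub>\<close>, and comparing the
  coefficients is an identity between three binomial coefficients (\<open>binomial_combination\<close>).
\<close>

section \<open>Congruences between p-integral rationals\<close>

locale prime_localization =
  fixes p :: nat
  assumes prime_p: "prime p"
begin

definition Zloc :: "rat set" where
  "Zloc = {x. denom_coprime p x}"

text \<open>
  As \<open>inverse 0 = 0\<close>, zero has to be excluded explicitly.
\<close>

definition Zunits :: "rat set" where
  "Zunits = {x \<in> Zloc. x \<noteq> 0 \<and> inverse x \<in> Zloc}"

text \<open>
  The modulus is \<open>p\<^sup>n\<close>, with the exponent as the subscript. The two sides need not be \<open>p\<close>-integral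
  themselves, so that sums, differences and transitivity carry no membership conditions; only factors
  do.
\<close>

definition pcong :: "rat \<Rightarrow> nat \<Rightarrow> rat \<Rightarrow> bool"  ("(_ \<approx>\<^bsub>_\<^esub> _)" [51, 0, 51] 50) where
  "x \<approx>\<^bsub>n\<^esub> y \<longleftrightarrow> (\<exists>z\<in>Zloc. x - y = of_nat p ^ n * z)"

text \<open>
  The definition goes through the reduced fraction; closure under sums and products needs arbitrary
  fractions.
\<close>

lemma Zloc_iff: "x \<in> Zloc \<longleftrightarrow> (\<exists>a b. x = of_int a / of_int b \<and> \<not> int p dvd b)"
proof
  assume "x \<in> Zloc"
  obtain a b where q: "quotient_of x = (a, b)" by (cases "quotient_of x")
  from \<open>x \<in> Zloc\<close> have "coprime b (int p)" by (simp add: Zloc_def denom_coprime_def q)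
  with prime_p have "\<not> int p dvd b"
    by (metis coprime_common_divisor dvd_refl not_prime_unit prime_nat_int_transfer)
  with quotient_of_div[OF q] show "\<exists>a b. x = of_int a / of_int b \<and> \<not> int p dvd b" by blast
next
  assume "\<exists>a b. x = of_int a / of_int b \<and> \<not> int p dvd b"
  then obtain a b where x: "x = of_int a / of_int b" and b: "\<not> int p dvd b" by blast
  obtain c d where q: "quotient_of x = (c, d)" by (cases "quotient_of x")
  have x': "x = of_int c / of_int d" and d: "d > 0" and cd: "coprime c d"
    using quotient_of_div[OF q] quotient_of_denom_pos[OF q] quotient_of_coprime[OF q] by auto
  have "b \<noteq> 0" using b by auto
  with x x' d have "of_int (a * d) = (of_int (c * b) :: rat)" by (simp add: field_simps)
  hence eq: "a * d = c * b" by (simp only: of_int_eq_iff)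
  have "\<not> int p dvd d"
  proof
    assume "int p dvd d"
    hence "int p dvd c * b" using eq by (metis dvd_mult)
    with b prime_p have "int p dvd c" by (metis prime_dvd_mult_iff prime_nat_int_transfer)
    with \<open>int p dvd d\<close> cd prime_p show False
      by (meson coprime_common_divisor not_prime_unit prime_nat_int_transfer)
  qed
  with prime_p have "coprime d (int p)"
    by (metis coprime_commute prime_imp_coprime prime_nat_int_transfer)
  thus "x \<in> Zloc" by (simp add: Zloc_def denom_coprime_def q)
qed

lemma Zloc_of_int [simp]: "of_int a \<in> Zloc"
  unfolding Zloc_iff by (rule exI[of _ a], rule exI[of _ 1])
    (use prime_gt_1_nat[OF prime_p] in auto)

lemma Zloc_of_nat [simp]: "of_nat a \<in> Zloc"
  using Zloc_of_int[of "int a"] by simp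

lemma Zloc_0 [simp]: "0 \<in> Zloc" and Zloc_1 [simp]: "1 \<in> Zloc"
  and Zloc_numeral [simp]: "numeral k \<in> Zloc"
  using Zloc_of_int[of 0] Zloc_of_int[of 1] Zloc_of_int[of "numeral k"] by simp_all

lemma Zloc_mult [simp]: "x \<in> Zloc \<Longrightarrow> y \<in> Zloc \<Longrightarrow> x * y \<in> Zloc"
proof -
  assume "x \<in> Zloc" "y \<in> Zloc"
  then obtain a b c d where x: "x = of_int a / of_int b" "\<not> int p dvd b"
    and y: "y = of_int c / of_int d" "\<not> int p dvd d" unfolding Zloc_iff by blast
  have "\<not> int p dvd b * d"
    using x(2) y(2) prime_p by (metis prime_dvd_mult_iff prime_nat_int_transfer)
  moreover have "x * y = of_int (a * c) / of_int (b * d)" by (simp add: x y)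
  ultimately show ?thesis unfolding Zloc_iff by blast
qed

lemma Zloc_add [simp]: "x \<in> Zloc \<Longrightarrow> y \<in> Zloc \<Longrightarrow> x + y \<in> Zloc"
proof -
  assume "x \<in> Zloc" "y \<in> Zloc"
  then obtain a b c d where x: "x = of_int a / of_int b" "\<not> int p dvd b"
    and y: "y = of_int c / of_int d" "\<not> int p dvd d" unfolding Zloc_iff by blast
  have "\<not> int p dvd b * d"
    using x(2) y(2) prime_p by (metis prime_dvd_mult_iff prime_nat_int_transfer)
  moreover have "x + y = of_int (a * d + c * b) / of_int (b * d)"
    using x(2) y(2) by (subst x, subst y, subst add_frac_eq) auto
  ultimately show ?thesis unfolding Zloc_iff by blast
qed

lemma Zloc_uminus [simp]: "x \<in> Zloc \<Longrightarrow> - x \<in> Zloc"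
  using Zloc_mult[OF Zloc_of_int[of "-1"], of x] by simp

lemma Zloc_diff [simp]: "x \<in> Zloc \<Longrightarrow> y \<in> Zloc \<Longrightarrow> x - y \<in> Zloc"
  using Zloc_add[OF _ Zloc_uminus, of x y] by simp

lemma Zloc_power [simp]: "x \<in> Zloc \<Longrightarrow> x ^ n \<in> Zloc"
  by (induction n) auto

lemma Zloc_sum [simp]: "(\<And>i. i \<in> A \<Longrightarrow> f i \<in> Zloc) \<Longrightarrow> sum f A \<in> Zloc"
  by (induction A rule: infinite_finite_induct) auto

lemma Zunits_int_iff: "of_int a \<in> Zunits \<longleftrightarrow> \<not> int p dvd a"
proof
  assume u: "of_int a \<in> Zunits"
  show "\<not> int p dvd a"
  proof
    assume "int p dvd a"
    from u have "inverse (of_int a) \<in> Zloc" and a0: "a \<noteq> 0" by (auto simp: Zunits_def)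
    then obtain c d where cd: "inverse (of_int a) = (of_int c / of_int d :: rat)"
      and d: "\<not> int p dvd d" unfolding Zloc_iff by blast
    from d have "d \<noteq> 0" by auto
    with cd a0 have "of_int d = (of_int (a * c) :: rat)" by (simp add: field_simps)
    hence "d = a * c" by (simp only: of_int_eq_iff)
    with \<open>int p dvd a\<close> d show False by simp
  qed
next
  assume a: "\<not> int p dvd a"
  have "inverse (of_int a) \<in> Zloc" unfolding Zloc_iff
    by (rule exI[of _ 1], rule exI[of _ a]) (use a in \<open>auto simp: field_simps\<close>)
  with a show "of_int a \<in> Zunits" by (auto simp: Zunits_def)
qed

lemma Zunits_nat_iff: "of_nat a \<in> Zunits \<longleftrightarrow> \<not> p dvd a"
  using Zunits_int_iff[of "int a"] by simp

lemma Zunits_less [intro]: "0 < a \<Longrightarrow> a < p \<Longrightarrow> of_nat a \<in> Zunits"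
  by (auto simp: Zunits_nat_iff dest: dvd_imp_le)

lemma Zunits_Zloc [simp, intro]: "x \<in> Zunits \<Longrightarrow> x \<in> Zloc"
  and Zunits_nonzero [simp]: "x \<in> Zunits \<Longrightarrow> x \<noteq> 0"
  and Zunits_inverse [simp]: "x \<in> Zunits \<Longrightarrow> inverse x \<in> Zloc"
  by (auto simp: Zunits_def)

lemma ZunitsI: "x \<in> Zloc \<Longrightarrow> x \<noteq> 0 \<Longrightarrow> inverse x \<in> Zloc \<Longrightarrow> x \<in> Zunits"
  by (simp only: Zunits_def) blast

lemma Zloc_divide [simp]: "x \<in> Zloc \<Longrightarrow> y \<in> Zunits \<Longrightarrow> x / y \<in> Zloc"
  by (simp add: divide_inverse)

lemma Zunits_mult: "x \<in> Zunits \<Longrightarrow> y \<in> Zunits \<Longrightarrow> x * y \<in> Zunits"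
  by (rule ZunitsI) auto

lemma Zunits_powi [simp]: "x \<in> Zunits \<Longrightarrow> x powi n \<in> Zunits"
proof -
  assume x: "x \<in> Zunits"
  hence "x powi n \<in> Zloc" and "inverse x powi n \<in> Zloc"
    using x by (auto simp: power_int_def)
  with x show ?thesis by (intro ZunitsI) (auto simp: power_int_inverse)
qed

lemma pcong_refl [simp]: "x \<approx>\<^bsub>n\<^esub> x"
  unfolding pcong_def by (rule bexI[of _ 0]) auto

lemma pcong_sym: "x \<approx>\<^bsub>n\<^esub> y \<Longrightarrow> y \<approx>\<^bsub>n\<^esub> x"
proof -
  assume "x \<approx>\<^bsub>n\<^esub> y"
  then obtain z where "z \<in> Zloc" "x - y = of_nat p ^ n * z" unfolding pcong_def by blast
  thus ?thesis unfolding pcong_def by (intro bexI[of _ "- z"]) (auto simp: algebra_simps)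
qed

lemma pcong_add: "x \<approx>\<^bsub>n\<^esub> y \<Longrightarrow> x' \<approx>\<^bsub>n\<^esub> y' \<Longrightarrow> x + x' \<approx>\<^bsub>n\<^esub> y + y'"
proof -
  assume "x \<approx>\<^bsub>n\<^esub> y" "x' \<approx>\<^bsub>n\<^esub> y'"
  then obtain z z' where "z \<in> Zloc" "x - y = of_nat p ^ n * z"
    and "z' \<in> Zloc" "x' - y' = of_nat p ^ n * z'" unfolding pcong_def by blast
  thus ?thesis unfolding pcong_def by (intro bexI[of _ "z + z'"]) (auto simp: algebra_simps)
qed

lemma pcong_trans [trans]: "x \<approx>\<^bsub>n\<^esub> y \<Longrightarrow> y \<approx>\<^bsub>n\<^esub> z \<Longrightarrow> x \<approx>\<^bsub>n\<^esub> z"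
proof -
  assume "x \<approx>\<^bsub>n\<^esub> y" "y \<approx>\<^bsub>n\<^esub> z"
  from pcong_add[OF this] show ?thesis by (simp add: pcong_def)
qed

lemma pcong_mult_left: "x \<approx>\<^bsub>n\<^esub> y \<Longrightarrow> c \<in> Zloc \<Longrightarrow> c * x \<approx>\<^bsub>n\<^esub> c * y"
proof -
  assume "x \<approx>\<^bsub>n\<^esub> y" and c: "c \<in> Zloc"
  then obtain z where "z \<in> Zloc" "x - y = of_nat p ^ n * z" unfolding pcong_def by blast
  moreover from this have "c * x - c * y = of_nat p ^ n * (c * z)"
    by (simp flip: right_diff_distrib)
  ultimately show ?thesis using c unfolding pcong_def by (intro bexI[of _ "c * z"]) auto
qed

lemma pcong_mult:
  assumes "x \<approx>\<^bsub>n\<^esub> y" "x' \<approx>\<^bsub>n\<^esub> y'" "x' \<in> Zloc" "y \<in> Zloc"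
  shows "x * x' \<approx>\<^bsub>n\<^esub> y * y'"
proof -
  have "x' * x \<approx>\<^bsub>n\<^esub> x' * y" using assms by (intro pcong_mult_left)
  moreover have "y * x' \<approx>\<^bsub>n\<^esub> y * y'" using assms by (intro pcong_mult_left)
  ultimately show ?thesis using pcong_trans by (simp only: mult.commute[of x' x] mult.commute[of x' y])
qed

lemma pcong_minus: "x \<approx>\<^bsub>n\<^esub> y \<Longrightarrow> - x \<approx>\<^bsub>n\<^esub> - y"
  using pcong_mult_left[of x n y "-1"] by simp

lemma pcong_diff: "x \<approx>\<^bsub>n\<^esub> y \<Longrightarrow> x' \<approx>\<^bsub>n\<^esub> y' \<Longrightarrow> x - x' \<approx>\<^bsub>n\<^esub> y - y'"
  using pcong_add[OF _ pcong_minus, of x n y x' y'] by simp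

lemma pcong_sum: "(\<And>i. i \<in> A \<Longrightarrow> f i \<approx>\<^bsub>n\<^esub> g i) \<Longrightarrow> sum f A \<approx>\<^bsub>n\<^esub> sum g A"
  by (induction A rule: infinite_finite_induct) (auto intro: pcong_add)

lemma pcong_prod:
  "(\<And>i. i \<in> A \<Longrightarrow> f i \<approx>\<^bsub>n\<^esub> g i \<and> f i \<in> Zloc \<and> g i \<in> Zloc) \<Longrightarrow>
     prod f A \<approx>\<^bsub>n\<^esub> prod g A \<and> prod f A \<in> Zloc \<and> prod g A \<in> Zloc"
  by (induction A rule: infinite_finite_induct) (auto intro: pcong_mult)

lemma pcong_cancel: "c * x \<approx>\<^bsub>n\<^esub> c * y \<Longrightarrow> c \<in> Zunits \<Longrightarrow> x \<approx>\<^bsub>n\<^esub> y"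
  using pcong_mult_left[of "c * x" n "c * y" "inverse c"] by (simp add: mult.assoc[symmetric])

lemma pcong_weaken: "x \<approx>\<^bsub>n\<^esub> y \<Longrightarrow> m \<le> n \<Longrightarrow> x \<approx>\<^bsub>m\<^esub> y"
proof -
  assume "x \<approx>\<^bsub>n\<^esub> y" "m \<le> n"
  then obtain z where z: "z \<in> Zloc" "x - y = of_nat p ^ n * z" unfolding pcong_def by blast
  have "x - y = of_nat p ^ m * (of_nat p ^ (n - m) * z)"
    using z(2) power_add[of "of_nat p :: rat" m "n - m"] \<open>m \<le> n\<close> by simp
  with z(1) show ?thesis unfolding pcong_def by (intro bexI[of _ "of_nat p ^ (n - m) * z"]) auto
qed

lemma pcong_mult_zeros: "x \<approx>\<^bsub>m\<^esub> 0 \<Longrightarrow> y \<approx>\<^bsub>n\<^esub> 0 \<Longrightarrow> x * y \<approx>\<^bsub>m + n\<^esub> 0"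
proof -
  assume "x \<approx>\<^bsub>m\<^esub> 0" "y \<approx>\<^bsub>n\<^esub> 0"
  then obtain z w where "z \<in> Zloc" "w \<in> Zloc" "x = of_nat p ^ m * z" "y = of_nat p ^ n * w"
    unfolding pcong_def by auto
  thus ?thesis unfolding pcong_def by (intro bexI[of _ "z * w"]) (auto simp: power_add)
qed

lemma pcong_zero_iff: "x - y \<approx>\<^bsub>n\<^esub> 0 \<longleftrightarrow> x \<approx>\<^bsub>n\<^esub> y"
  by (simp add: pcong_def)

lemma pcong_p_power: "z \<in> Zloc \<Longrightarrow> of_nat p ^ n * z \<approx>\<^bsub>n\<^esub> 0"
  by (auto simp: pcong_def)

lemma pcong_p: "z \<in> Zloc \<Longrightarrow> of_nat p * z \<approx>\<^bsub>1\<^esub> 0"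
  using pcong_p_power[of z 1] by simp

text \<open>
  All correction terms in the final evaluation carry an explicit factor \<open>p\<close>, so they are needed only
  modulo \<open>p\<close>.
\<close>

lemma pcong_lift: "x \<approx>\<^bsub>1\<^esub> y \<Longrightarrow> of_nat p * x \<approx>\<^bsub>2\<^esub> of_nat p * y"
  using pcong_mult_zeros[OF pcong_p[OF Zloc_1], of "x - y" 1]
  by (simp add: pcong_zero_iff right_diff_distrib numeral_2_eq_2)

text \<open>
  The ring is local with maximal ideal generated by \<open>p\<close>.
\<close>

lemma Zunits_if_not_pcong_0:
  assumes "x \<in> Zloc" "\<not> x \<approx>\<^bsub>1\<^esub> 0"
  shows "x \<in> Zunits"
proof -
  from assms(1) obtain a b where x: "x = of_int a / of_int b" and b: "\<not> int p dvd b"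
    unfolding Zloc_iff by blast
  have "\<not> int p dvd a"
  proof
    assume "int p dvd a"
    then obtain c where "a = int p * c" by blast
    with x b have "x = of_nat p * (of_int c / of_int b)" by simp
    moreover have "of_int c / of_int b \<in> Zloc" unfolding Zloc_iff using b by blast
    ultimately show False using assms(2) pcong_p by metis
  qed
  hence "inverse x \<in> Zloc" unfolding Zloc_iff
    by (intro exI[of _ b] exI[of _ a]) (simp add: x)
  moreover have "x \<noteq> 0" using \<open>\<not> int p dvd a\<close> b x by auto
  ultimately show ?thesis using assms(1) by (intro ZunitsI)
qed

lemma of_nat_pcong_iff: "of_nat a \<approx>\<^bsub>1\<^esub> of_nat b \<longleftrightarrow> [a = b] (mod p)"
proof -
  have "of_nat a \<approx>\<^bsub>1\<^esub> of_nat b \<longleftrightarrow> \<not> (of_int (int a - int b) \<in> Zunits)"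
  proof
    assume "of_nat a \<approx>\<^bsub>1\<^esub> of_nat b"
    then obtain z where z: "z \<in> Zloc" "of_int (int a - int b) = of_nat p * z"
      by (auto simp: pcong_def)
    show "\<not> (of_int (int a - int b) \<in> Zunits)"
    proof
      assume u: "of_int (int a - int b) \<in> Zunits"
      hence "of_nat p * z \<noteq> 0" using z(2) Zunits_nonzero by metis
      have "inverse (of_nat p * z) * z \<in> Zloc" using u z Zunits_inverse by (metis Zloc_mult)
      moreover have "inverse (of_nat p * z) * z = inverse (of_nat p)"
        using \<open>of_nat p * z \<noteq> 0\<close> by (simp add: field_simps)
      ultimately have "inverse (of_nat p) \<in> Zloc" by (simp only:)
      moreover have "(of_nat p :: rat) \<noteq> 0" using \<open>of_nat p * z \<noteq> 0\<close> by auto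
      ultimately have "of_nat p \<in> Zunits" by (intro ZunitsI) auto
      thus False by (simp add: Zunits_nat_iff)
    qed
  next
    assume "\<not> (of_int (int a - int b) \<in> Zunits)"
    hence "of_int (int a - int b) \<approx>\<^bsub>1\<^esub> 0" using Zunits_if_not_pcong_0 Zloc_of_int by blast
    thus "of_nat a \<approx>\<^bsub>1\<^esub> of_nat b" by (simp add: pcong_zero_iff)
  qed
  also have "\<dots> \<longleftrightarrow> [int a = int b] (mod int p)" by (simp only: Zunits_int_iff cong_iff_dvd_diff not_not)
  finally show ?thesis by (simp add: cong_int_iff)
qed

section \<open>Power sums with integer exponents\<close>

text \<open>
  The error \<open>y * T n - T (n + 1)\<close> of the linear approximation \<open>T n\<close> is divisible by \<open>p\<^sup>2\<close>. As \<open>y\<close> is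
  a unit, this passes from \<open>n\<close> to \<open>n + 1\<close> and also from \<open>n\<close> to \<open>n - 1\<close>, so positive and negative
  exponents are covered by one argument.
\<close>

lemma powi_taylor:
  assumes x: "x \<in> Zunits" and y: "y \<in> Zunits" and q: "q \<in> Zloc" and yx: "y = x + of_nat p * q"
  shows "y powi n \<approx>\<^bsub>2\<^esub> x powi n + of_int n * (of_nat p * q) * x powi (n - 1)"
proof -
  define T where "T n = x powi n + of_int n * (of_nat p * q) * x powi (n - 1)" for n
  have shift: "y * T n \<approx>\<^bsub>2\<^esub> T (n + 1)" for n
  proof -
    have "x \<noteq> 0" using x by simp
    hence "x powi n = x powi (n - 1) * x" "x powi (n + 1) = x powi (n - 1) * x * x"
      using power_int_add_1[of x "n - 1"] power_int_add_1[of x n] by simp_all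
    hence "y * T n - T (n + 1) = of_nat p ^ 2 * (of_int n * q * q * x powi (n - 1))"
      by (simp add: T_def yx algebra_simps power2_eq_square)
    moreover have "of_int n * q * q * x powi (n - 1) \<in> Zloc" using x q by simp
    ultimately show ?thesis unfolding pcong_def by blast
  qed
  have "y powi n \<approx>\<^bsub>2\<^esub> T n"
  proof (induction n rule: int_induct[where k = 0])
    case base
    show ?case by (simp add: T_def)
  next
    case (step1 n)
    have "y * y powi n \<approx>\<^bsub>2\<^esub> y * T n" using step1.IH y by (intro pcong_mult_left) auto
    also note shift
    also have "y * y powi n = y powi (n + 1)" using y by (simp add: power_int_add_1')
    finally show ?case .
  next
    case (step2 n)
    have "y * y powi (n - 1) = y powi n" using y power_int_add_1'[of y "n - 1"] by simp
    also note step2.IH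
    also have "T n \<approx>\<^bsub>2\<^esub> y * T (n - 1)" using pcong_sym[OF shift[of "n - 1"]] by simp
    finally show ?case using y by (rule pcong_cancel)
  qed
  thus ?thesis by (simp add: T_def)
qed

lemma powi_pcong:
  assumes x: "x \<in> Zunits" and y: "y \<in> Zunits" and xy: "x \<approx>\<^bsub>1\<^esub> y"
  shows "x powi n \<approx>\<^bsub>1\<^esub> y powi n"
proof -
  from xy obtain q where q: "q \<in> Zloc" and "x = y + of_nat p * q"
    unfolding pcong_def by (auto simp: algebra_simps)
  hence "x powi n \<approx>\<^bsub>2\<^esub> y powi n + of_int n * (of_nat p * q) * y powi (n - 1)"
    using x y by (intro powi_taylor)
  hence "x powi n \<approx>\<^bsub>1\<^esub> y powi n + of_int n * (of_nat p * q) * y powi (n - 1)"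
    by (rule pcong_weaken) simp
  also have "of_int n * (of_nat p * q) * y powi (n - 1) = of_nat p * (of_int n * q * y powi (n - 1))"
    by simp
  also have "y powi n + \<dots> \<approx>\<^bsub>1\<^esub> y powi n + 0" using q y by (intro pcong_add pcong_p) auto
  finally show ?thesis by simp
qed

text \<open>
  Fermat's little theorem, extended to integer exponents.
\<close>

lemma powi_exponent_pcong:
  assumes a: "\<not> p dvd a" and ef: "int (p - 1) dvd e - f"
  shows "of_nat a powi e \<approx>\<^bsub>1\<^esub> of_nat a powi f"
proof -
  from ef obtain t where t: "e = f + int (p - 1) * t" by (auto simp: dvd_def algebra_simps)
  have u: "of_nat a \<in> Zunits" using a by (simp add: Zunits_nat_iff)
  have "of_nat (a ^ (p - 1)) \<approx>\<^bsub>1\<^esub> of_nat 1"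
    unfolding of_nat_pcong_iff using prime_p a by (rule fermat_theorem)
  hence "of_nat a powi int (p - 1) \<approx>\<^bsub>1\<^esub> 1" by simp
  hence "(of_nat a powi int (p - 1)) powi t \<approx>\<^bsub>1\<^esub> 1 powi t"
    using u Zunits_nat_iff[of 1] prime_gt_1_nat[OF prime_p] by (intro powi_pcong Zunits_powi) auto
  hence "of_nat a powi f * (of_nat a powi int (p - 1)) powi t \<approx>\<^bsub>1\<^esub> of_nat a powi f * 1 powi t"
    using u by (intro pcong_mult_left) auto
  also have "of_nat a powi f * (of_nat a powi int (p - 1)) powi t = (of_nat a :: rat) powi e"
    using Zunits_nonzero[OF u]
    by (simp only: t power_int_add power_int_mult not_False_eq_True disj_not1 simp_thms)
  finally show ?thesis by simp
qed

lemma primitive_root_powi: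
  obtains g where "\<not> p dvd g" "\<And>e. \<not> int (p - 1) dvd e \<Longrightarrow> of_nat g powi e - 1 \<in> Zunits"
proof -
  obtain g where "residue_primroot p g" using prime_primitive_root_exists[OF prime_gt_1_nat[OF prime_p] prime_p] by blast
  hence cop: "coprime p g" and ord: "ord p g = p - 1"
    by (auto simp: residue_primroot_def totient_prime[OF prime_p])
  have g: "\<not> p dvd g" using cop prime_p by (metis coprime_absorb_left not_prime_unit)
  have "of_nat g powi e - 1 \<in> Zunits" if e: "\<not> int (p - 1) dvd e" for e
  proof (rule Zunits_if_not_pcong_0)
    show "of_nat g powi e - 1 \<in> Zloc" using g by (simp add: Zunits_nat_iff)
    define k where "k = nat (e mod int (p - 1))"
    have p1: "p - 1 > 0" using prime_gt_1_nat[OF prime_p] by simp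
    hence k: "int k = e mod int (p - 1)" by (simp add: k_def)
    show "\<not> of_nat g powi e - 1 \<approx>\<^bsub>1\<^esub> 0"
    proof
      assume "of_nat g powi e - 1 \<approx>\<^bsub>1\<^esub> 0"
      hence "of_nat g powi e \<approx>\<^bsub>1\<^esub> 1" by (simp add: pcong_zero_iff)
      moreover have "int (p - 1) dvd int k - e" unfolding k
        by (simp add: mod_eq_dvd_iff [symmetric])
      hence "of_nat g powi int k \<approx>\<^bsub>1\<^esub> of_nat g powi e" by (rule powi_exponent_pcong[OF g])
      ultimately have "of_nat (g ^ k) \<approx>\<^bsub>1\<^esub> of_nat 1" using pcong_trans by simp
      hence "p - 1 dvd k" by (simp only: of_nat_pcong_iff ord_divides ord)
      hence "int (p - 1) dvd int k" by (simp only: int_dvd_int_iff)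
      thus False using e k by (simp add: dvd_mod_iff)
    qed
  qed
  with g that show ?thesis by blast
qed

definition power_sum :: "int \<Rightarrow> rat" where
  "power_sum e = (\<Sum>j\<in>{1..<p}. of_nat j powi e)"

lemma power_sum_Zloc [simp]: "power_sum e \<in> Zloc"
  unfolding power_sum_def by (intro Zloc_sum Zunits_Zloc Zunits_powi Zunits_less) auto

text \<open>
  Multiplication by a unit permutes the nonzero residues.
\<close>

lemma sum_mult_mod:
  assumes "\<not> p dvd a"
  shows "(\<Sum>j\<in>{1..<p}. f (a * j mod p)) = sum f {1..<p}"
proof -
  have cop: "coprime a p" using prime_imp_coprime[OF prime_p assms] by (simp add: coprime_commute)
  have inj: "inj_on (\<lambda>m. a * m mod p) {1..<p}"
  proof (rule inj_onI)
    fix i j assume ij: "i \<in> {1..<p}" "j \<in> {1..<p}" and "a * i mod p = a * j mod p"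
    hence "[i = j] (mod p)" using cop by (simp add: cong_mult_lcancel_nat flip: cong_def)
    with ij show "i = j" by (simp add: cong_less_modulus_unique_nat)
  qed
  have "a * m mod p \<in> {1..<p}" if "m \<in> {1..<p}" for m
  proof -
    have "\<not> p dvd a * m"
      using assms that prime_p by (auto simp: prime_dvd_mult_iff dest: dvd_imp_le)
    thus ?thesis using prime_gt_0_nat[OF prime_p] by (simp add: dvd_eq_mod_eq_0 Suc_le_eq)
  qed
  with inj have "bij_betw (\<lambda>m. a * m mod p) {1..<p} {1..<p}"
    unfolding bij_betw_def by (intro conjI endo_inj_surj) auto
  thus ?thesis by (rule sum.reindex_bij_betw)
qed

lemma mult_mod_Zunits:
  assumes "\<not> p dvd a" "j \<in> {1..<p}"
  shows "of_nat (a * j mod p) \<in> Zunits" "of_nat (a * j) \<in> Zunits"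
proof -
  have "\<not> p dvd a * j"
    using assms prime_p by (auto simp: prime_dvd_mult_iff dest: dvd_imp_le)
  thus "of_nat (a * j mod p) \<in> Zunits" "of_nat (a * j) \<in> Zunits"
    by (auto simp: Zunits_nat_iff dvd_mod_iff simp del: of_nat_mult)
qed

text \<open>
  Voronoi's congruence. With \<open>a j = r + p q\<close>, where \<open>r\<close> is the residue and \<open>q\<close> the quotient, the
  Taylor expansion gives \<open>(a j)\<^sup>e \<equiv> r\<^sup>e + e p q r\<^bsup>e-1\<^esup>\<close>, and \<open>r\<close> runs over the same residues as \<open>j\<close>.
\<close>

lemma voronoi:
  assumes a: "\<not> p dvd a"
  shows "(of_nat a powi e - 1) * power_sum e \<approx>\<^bsub>2\<^esub>
    of_nat p * (of_int e * (\<Sum>j\<in>{1..<p}. of_nat (a * j div p) * of_nat (a * j mod p) powi (e - 1)))"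
proof -
  have "of_nat a powi e * power_sum e = (\<Sum>j\<in>{1..<p}. of_nat (a * j) powi e)"
    by (simp add: power_sum_def sum_distrib_left power_int_mult_distrib)
  also have "\<dots> \<approx>\<^bsub>2\<^esub> (\<Sum>j\<in>{1..<p}. of_nat (a * j mod p) powi e +
      of_int e * (of_nat p * of_nat (a * j div p)) * of_nat (a * j mod p) powi (e - 1))"
  proof (intro pcong_sum powi_taylor)
    fix j assume j: "j \<in> {1..<p}"
    show "of_nat (a * j mod p) \<in> Zunits" "of_nat (a * j) \<in> Zunits"
      using mult_mod_Zunits[OF a j] by auto
    show "of_nat (a * j div p) \<in> Zloc" by simp
    have "a * j = a * j mod p + p * (a * j div p)" by simp
    thus "(of_nat (a * j) :: rat) = of_nat (a * j mod p) + of_nat p * of_nat (a * j div p)"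
      by (metis of_nat_add of_nat_mult)
  qed
  also have "\<dots> = power_sum e + of_nat p *
     (of_int e * (\<Sum>j\<in>{1..<p}. of_nat (a * j div p) * of_nat (a * j mod p) powi (e - 1)))"
    using sum_mult_mod[OF a, of "\<lambda>i. of_nat i powi e :: rat"]
    by (simp add: sum.distrib power_sum_def sum_distrib_left mult_ac)
  finally have "of_nat a powi e * power_sum e - power_sum e \<approx>\<^bsub>2\<^esub> power_sum e + of_nat p *
     (of_int e * (\<Sum>j\<in>{1..<p}. of_nat (a * j div p) * of_nat (a * j mod p) powi (e - 1)))
     - power_sum e"
    by (intro pcong_diff pcong_refl)
  thus ?thesis by (simp add: algebra_simps)
qed

lemma power_sum_pcong_0:
  assumes "\<not> int (p - 1) dvd e"
  shows "power_sum e \<approx>\<^bsub>1\<^esub> 0"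
proof -
  obtain g where g: "\<not> p dvd g" "of_nat g powi e - 1 \<in> Zunits"
    using primitive_root_powi assms by metis
  define Q where
    "Q = of_int e * (\<Sum>j\<in>{1..<p}. of_nat (g * j div p) * of_nat (g * j mod p) powi (e - 1) :: rat)"
  have "Q \<in> Zloc" unfolding Q_def
    using mult_mod_Zunits(1)[OF g(1)] by (intro Zloc_mult Zloc_sum Zunits_Zloc[OF Zunits_powi]) auto
  have "(of_nat g powi e - 1) * power_sum e \<approx>\<^bsub>1\<^esub> of_nat p * Q"
    using voronoi[OF g(1)] unfolding Q_def by (rule pcong_weaken) simp
  also have "\<dots> \<approx>\<^bsub>1\<^esub> (of_nat g powi e - 1) * 0" using pcong_p[OF \<open>Q \<in> Zloc\<close>] by simp
  finally show ?thesis using g(2) by (rule pcong_cancel)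
qed

lemma power_sum_pcong_minus_1:
  assumes "int (p - 1) dvd e"
  shows "power_sum e \<approx>\<^bsub>1\<^esub> - 1"
proof -
  have "power_sum e \<approx>\<^bsub>1\<^esub> (\<Sum>j\<in>{1..<p}. of_nat j powi 0)"
    unfolding power_sum_def using assms
    by (intro pcong_sum powi_exponent_pcong) (auto dest: dvd_imp_le)
  also have "\<dots> = of_nat p * 1 + (- 1)"
    using prime_gt_0_nat[OF prime_p] by (simp add: of_nat_diff)
  also have "\<dots> \<approx>\<^bsub>1\<^esub> 0 + (- 1)" by (intro pcong_add pcong_p) auto
  finally show ?thesis by simp
qed

text \<open>
  Apart from the factor \<open>e\<close>, the right-hand side of Voronoi's congruence matters only modulo \<open>p\<close>, where
  it depends on \<open>e\<close> only modulo \<open>p - 1\<close>. Choosing \<open>a\<close> to be a primitive root makes \<open>a\<^sup>e - 1\<close> a unit,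
  which can be cancelled.
\<close>

lemma power_sum_ratio:
  assumes ef: "int (p - 1) dvd e - f" and e: "\<not> int (p - 1) dvd e"
  shows "of_int f * power_sum e \<approx>\<^bsub>2\<^esub> of_int e * power_sum f"
proof -
  have f: "\<not> int (p - 1) dvd f" using e ef by (metis dvd_diff_left_iff)
  obtain g where g: "\<not> p dvd g" "of_nat g powi e - 1 \<in> Zunits"
    using primitive_root_powi e by metis
  define Q where
    "Q k = (\<Sum>j\<in>{1..<p}. of_nat (g * j div p) * of_nat (g * j mod p) powi (k - 1) :: rat)" for k
  have Q: "Q e \<approx>\<^bsub>1\<^esub> Q f" unfolding Q_def
    using mult_mod_Zunits(1)[OF g(1)] ef
    by (intro pcong_sum pcong_mult_left powi_exponent_pcong) (auto simp flip: Zunits_nat_iff)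
  let ?ge = "of_nat g powi e - 1 :: rat" and ?gf = "of_nat g powi f - 1 :: rat"
  have "of_int f * (?ge * power_sum e) \<approx>\<^bsub>2\<^esub> of_int f * (of_nat p * (of_int e * Q e))"
    unfolding Q_def by (intro pcong_mult_left voronoi g) auto
  also have "of_int f * (of_nat p * (of_int e * Q e)) = of_int (e * f) * (of_nat p * Q e)" by simp
  also have "\<dots> \<approx>\<^bsub>2\<^esub> of_int (e * f) * (of_nat p * Q f)"
    by (intro pcong_mult_left pcong_lift Q Zloc_of_int)
  also have "of_int (e * f) * (of_nat p * Q f) = of_int e * (of_nat p * (of_int f * Q f))" by simp
  also have "\<dots> \<approx>\<^bsub>2\<^esub> of_int e * (?gf * power_sum f)"
    unfolding Q_def by (intro pcong_mult_left pcong_sym[OF voronoi] g) auto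
  \<comment> \<open>Both \<open>?gf - ?ge\<close> and the power sum are divisible by \<open>p\<close>.\<close>
  also have "?gf * power_sum f \<approx>\<^bsub>2\<^esub> ?ge * power_sum f"
  proof -
    have "of_nat g powi f \<approx>\<^bsub>1\<^esub> of_nat g powi e"
      using ef by (intro powi_exponent_pcong g) (simp add: dvd_diff_commute)
    hence "?gf - ?ge \<approx>\<^bsub>1\<^esub> 0" by (simp add: pcong_zero_iff)
    from pcong_mult_zeros[OF this power_sum_pcong_0[OF f]]
    have "(?gf - ?ge) * power_sum f \<approx>\<^bsub>2\<^esub> 0" by (simp only: one_add_one)
    thus ?thesis by (simp only: left_diff_distrib pcong_zero_iff)
  qed
  hence "of_int e * (?gf * power_sum f) \<approx>\<^bsub>2\<^esub> of_int e * (?ge * power_sum f)"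
    by (intro pcong_mult_left) auto
  finally have "?ge * (of_int f * power_sum e) \<approx>\<^bsub>2\<^esub> ?ge * (of_int e * power_sum f)"
    by (simp only: mult.left_commute)
  thus ?thesis using g(2) by (rule pcong_cancel)
qed

end

section \<open>Bernoulli numbers and Faulhaber's formula\<close>

lemma bernoulli_recurrence:
  "(\<Sum>k\<le>n. of_nat (Suc n choose k) * bernoulli k) = (if n = 0 then 1 else 0)"
proof (cases n)
  case 0
  thus ?thesis by (simp add: bernoulli.simps)
next
  case (Suc m)
  have "(Suc n choose Suc m) = m + 2" using Suc by simp
  thus ?thesis using Suc by (simp add: bernoulli.simps(2)[of m] field_simps del: of_nat_Suc of_nat_add binomial_Suc_Suc)
qed

lemma binomial_swap:
  assumes "k + l \<le> n"
  shows "(n choose k) * ((n - k) choose l) = (n choose l) * ((n - l) choose k)"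
proof -
  have "of_nat ((n choose k) * ((n - k) choose l)) = (of_nat ((n choose l) * ((n - l) choose k)) :: rat)"
    using assms by (simp add: binomial_fact diff_diff_left add.commute)
  thus ?thesis by (simp only: of_nat_eq_iff)
qed

lemma triangle_swap:
  fixes F :: "nat \<Rightarrow> nat \<Rightarrow> 'a :: comm_monoid_add"
  shows "(\<Sum>k\<le>n. \<Sum>l\<le>n - k. F k l) = (\<Sum>l\<le>n. \<Sum>k\<le>n - l. F k l)"
proof -
  have "(\<Sum>k\<le>n. \<Sum>l\<le>n - k. F k l) = (\<Sum>(k, l)\<in>(SIGMA k:{..n}. {..n - k}). F k l)"
    by (rule sum.Sigma) auto
  also have "\<dots> = (\<Sum>(l, k)\<in>(SIGMA l:{..n}. {..n - l}). F k l)"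
    by (rule sum.reindex_bij_witness[of _ "\<lambda>(l, k). (k, l)" "\<lambda>(k, l). (l, k)"]) auto
  also have "\<dots> = (\<Sum>l\<le>n. \<Sum>k\<le>n - l. F k l)"
    by (rule sum.Sigma[symmetric]) auto
  finally show ?thesis .
qed

text \<open>
  Induction on \<open>m\<close>. The increment of the right-hand side is expanded by the binomial theorem; after
  exchanging the two summations the coefficient of \<open>x\<^sup>l\<close> contains the sum in the recurrence of the
  Bernoulli numbers of order \<open>n - l\<close>, which vanishes unless \<open>l = n\<close>.
\<close>

lemma faulhaber:
  "of_nat (Suc n) * (\<Sum>i<m. of_nat i ^ n) =
     (\<Sum>k\<le>n. of_nat (Suc n choose k) * bernoulli k * of_nat m ^ (Suc n - k))"
proof (induction m)
  case 0
  show ?case by (simp add: Suc_diff_le)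
next
  case (Suc m)
  define x :: rat where "x = of_nat m"
  have expand: "(x + 1) ^ Suc r - x ^ Suc r = (\<Sum>l\<le>r. of_nat (Suc r choose l) * x ^ l)" for r
  proof -
    have "(x + 1) ^ Suc r = (\<Sum>l\<le>Suc r. of_nat (Suc r choose l) * x ^ l)"
      unfolding binomial_ring by simp
    thus ?thesis by (simp del: binomial_Suc_Suc power_Suc)
  qed
  have "(\<Sum>k\<le>n. of_nat (Suc n choose k) * bernoulli k * (x + 1) ^ (Suc n - k)) -
        (\<Sum>k\<le>n. of_nat (Suc n choose k) * bernoulli k * x ^ (Suc n - k)) =
        (\<Sum>k\<le>n. of_nat (Suc n choose k) * bernoulli k * ((x + 1) ^ (Suc n - k) - x ^ (Suc n - k)))"
    by (simp only: right_diff_distrib sum_subtractf)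
  also have "\<dots> = (\<Sum>k\<le>n. \<Sum>l\<le>n - k.
      of_nat ((Suc n choose k) * (Suc (n - k) choose l)) * bernoulli k * x ^ l)"
  proof (intro sum.cong refl)
    fix k assume "k \<in> {..n}"
    hence "Suc n - k = Suc (n - k)" by (simp add: Suc_diff_le)
    thus "of_nat (Suc n choose k) * bernoulli k * ((x + 1) ^ (Suc n - k) - x ^ (Suc n - k)) =
      (\<Sum>l\<le>n - k. of_nat ((Suc n choose k) * (Suc (n - k) choose l)) * bernoulli k * x ^ l)"
      by (simp only: expand sum_distrib_left of_nat_mult mult_ac)
  qed
  also have "\<dots> = (\<Sum>l\<le>n. \<Sum>k\<le>n - l.
      of_nat ((Suc n choose k) * (Suc (n - k) choose l)) * bernoulli k * x ^ l)"
    by (rule triangle_swap)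
  also have "\<dots> = (\<Sum>l\<le>n. of_nat (Suc n choose l) * x ^ l *
      (\<Sum>k\<le>n - l. of_nat (Suc (n - l) choose k) * bernoulli k))"
    unfolding sum_distrib_left
  proof (intro sum.cong refl)
    fix l k assume "l \<in> {..n}" "k \<in> {..n - l}"
    hence "(Suc n choose k) * (Suc (n - k) choose l) = (Suc n choose l) * (Suc (n - l) choose k)"
      using binomial_swap[of k l "Suc n"] by (simp add: Suc_diff_le del: binomial_Suc_Suc)
    thus "of_nat ((Suc n choose k) * (Suc (n - k) choose l)) * bernoulli k * x ^ l =
        of_nat (Suc n choose l) * x ^ l * (of_nat (Suc (n - l) choose k) * bernoulli k)"
      by (simp only:) (simp only: of_nat_mult mult_ac)
  qed
  also have "\<dots> = (\<Sum>l\<le>n. if l = n then of_nat (Suc n) * x ^ n else 0)"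
    unfolding bernoulli_recurrence by (intro sum.cong refl) (auto simp del: binomial_Suc_Suc)
  also have "\<dots> = of_nat (Suc n) * x ^ n" by simp
  finally show ?case using Suc.IH by (simp add: x_def algebra_simps)
qed

context prime_localization
begin

text \<open>
  The recurrence for \<open>B\<^sub>k\<close> divides only by the numbers up to \<open>k + 1\<close>.
\<close>

lemma bernoulli_Zloc:
  assumes "k + 1 < p"
  shows "bernoulli k \<in> Zloc"
  using assms
proof (induction k rule: less_induct)
  case (less k)
  show ?case
  proof (cases k)
    case 0
    thus ?thesis by (simp add: bernoulli.simps)
  next
    case (Suc n)
    have "of_nat (n + 2) \<in> Zunits" using less.prems Suc by (intro Zunits_less) auto
    thus ?thesis using less Suc unfolding Suc bernoulli.simps(2)
      by (intro Zloc_divide Zloc_uminus Zloc_sum Zloc_mult) auto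
  qed
qed

text \<open>
  In Faulhaber's formula with upper limit \<open>p\<close>, every term except the one with \<open>k = n\<close> has a factor
  \<open>p\<^sup>2\<close>.
\<close>

lemma power_sum_bernoulli:
  assumes n: "0 < n" "n + 1 < p"
  shows "power_sum (int n) \<approx>\<^bsub>2\<^esub> of_nat p * bernoulli n"
proof -
  have "power_sum (int n) = (\<Sum>i<p. of_nat i ^ n)"
    unfolding power_sum_def using n by (intro sum.mono_neutral_cong_left) auto
  hence "of_nat (Suc n) * power_sum (int n) =
      (\<Sum>k\<le>n. of_nat (Suc n choose k) * bernoulli k * of_nat p ^ (Suc n - k))"
    by (simp only: faulhaber)
  also have "\<dots> = (\<Sum>k<n. of_nat (Suc n choose k) * bernoulli k * of_nat p ^ (Suc n - k)) +
      of_nat (Suc n) * (of_nat p * bernoulli n)"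
    unfolding lessThan_Suc_atMost[symmetric] by simp
  also have "\<dots> \<approx>\<^bsub>2\<^esub> (\<Sum>k<n. 0) + of_nat (Suc n) * (of_nat p * bernoulli n)"
  proof (intro pcong_add pcong_sum pcong_refl)
    fix k assume k: "k \<in> {..<n}"
    hence "Suc n - k = 2 + (n - 1 - k)" by auto
    hence "of_nat (Suc n choose k) * bernoulli k * of_nat p ^ (Suc n - k) =
      of_nat p ^ 2 * (of_nat (Suc n choose k) * bernoulli k * of_nat p ^ (n - 1 - k))"
      by (simp only: power_add mult_ac)
    also have "\<dots> \<approx>\<^bsub>2\<^esub> 0" using k n bernoulli_Zloc[of k] by (intro pcong_p_power) auto
    finally show "of_nat (Suc n choose k) * bernoulli k * of_nat p ^ (Suc n - k) \<approx>\<^bsub>2\<^esub> 0" .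
  qed
  finally have "of_nat (Suc n) * power_sum (int n) \<approx>\<^bsub>2\<^esub> of_nat (Suc n) * (of_nat p * bernoulli n)"
    by simp
  thus ?thesis using n by (rule_tac pcong_cancel[OF _ Zunits_less]) auto
qed

text \<open>
  The exponents \<open>- m\<close> and \<open>p - 1 - m\<close> are congruent modulo \<open>p - 1\<close>. The ratio of the two power sums is
  the ratio of the exponents; the factor \<open>p - 1 - m\<close> may be replaced by \<open>- (m + 1)\<close> because the
  power sum multiplied by it is divisible by \<open>p\<close>.
\<close>

lemma power_sum_neg:
  assumes m: "0 < m" "m + 1 < p"
  shows "of_nat (m + 1) * power_sum (- int m) \<approx>\<^bsub>2\<^esub> of_nat m * (of_nat p * bernoulli (p - 1 - m))"
proof -
  let ?f = "int (p - 1 - m)"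
  have nd: "\<not> int (p - 1) dvd - int m"
    using m by (simp only: dvd_minus_iff int_dvd_int_iff) (auto dest: dvd_imp_le)
  have "?f = int p - int (m + 1)" using m by simp
  hence f: "of_int ?f = of_nat p - (of_nat (m + 1) :: rat)" by (simp only: of_int_diff of_int_of_nat_eq)
  have "of_nat p * power_sum (- int m) \<approx>\<^bsub>2\<^esub> of_nat p * 0"
    by (intro pcong_lift power_sum_pcong_0 nd)
  moreover have "of_int ?f * power_sum (- int m) \<approx>\<^bsub>2\<^esub> of_int (- int m) * power_sum ?f"
  proof (intro power_sum_ratio nd)
    have "- int m - ?f = - int (p - 1)" using m by simp
    thus "int (p - 1) dvd - int m - ?f" by (simp only: dvd_minus_iff dvd_refl)
  qed
  ultimately have "of_nat p * power_sum (- int m) - of_int ?f * power_sum (- int m) \<approx>\<^bsub>2\<^esub>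
      of_nat p * 0 - of_int (- int m) * power_sum ?f"
    by (rule pcong_diff)
  hence "of_nat (m + 1) * power_sum (- int m) \<approx>\<^bsub>2\<^esub> of_nat m * power_sum ?f"
    unfolding f by (simp add: algebra_simps)
  also have "\<dots> \<approx>\<^bsub>2\<^esub> of_nat m * (of_nat p * bernoulli (p - 1 - m))"
    using m by (intro pcong_mult_left power_sum_bernoulli) auto
  finally show ?thesis .
qed

text \<open>
  Modulo \<open>p\<close> the upper index \<open>p - b\<close> acts as \<open>- b\<close>. The denominator \<open>c!\<close> is a unit.
\<close>

lemma binomial_p_minus_pcong:
  assumes b: "0 < b" "b \<le> p" and c: "c < p"
  shows "of_nat ((p - b) choose c) \<approx>\<^bsub>1\<^esub> (- 1) ^ c * of_nat ((b + c - 1) choose c)"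
proof -
  have u: "fact c \<in> Zunits"
  proof -
    have "of_nat (fact c) \<in> Zunits"
      unfolding Zunits_nat_iff using c by (simp add: prime_dvd_fact_iff[OF prime_p])
    thus ?thesis by simp
  qed
  have "fact c * of_nat ((p - b) choose c) = (\<Prod>i = 0..<c. of_nat p * 1 + (- of_nat b - of_nat i) :: rat)"
    using b by (simp add: binomial_gbinomial gbinomial_mult_fact of_nat_diff algebra_simps)
  also have "\<dots> \<approx>\<^bsub>1\<^esub> (\<Prod>i = 0..<c. 0 + (- of_nat b - of_nat i))"
  proof (rule conjunct1[OF pcong_prod], intro conjI)
    fix i
    show "of_nat p * 1 + (- of_nat b - of_nat i) \<approx>\<^bsub>1\<^esub> 0 + (- of_nat b - of_nat i)"
      by (intro pcong_add pcong_p pcong_refl) simp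
  qed auto
  also have "\<dots> = fact c * ((- of_nat b) gchoose c)" by (simp add: gbinomial_mult_fact)
  also have "\<dots> = fact c * ((- 1) ^ c * of_nat ((b + c - 1) choose c))"
    using b by (simp add: gbinomial_minus binomial_gbinomial of_nat_diff)
  finally show ?thesis using u by (rule pcong_cancel)
qed

section \<open>Double sums\<close>

definition double_sum :: "int \<Rightarrow> int \<Rightarrow> rat" where
  "double_sum e f = (\<Sum>j\<in>{1..<p}. \<Sum>i\<in>{1..<j}. of_nat i powi e * of_nat j powi f)"

lemma double_sum_Zloc [simp]: "double_sum e f \<in> Zloc"
  unfolding double_sum_def
  by (intro Zloc_sum Zloc_mult Zunits_Zloc Zunits_powi Zunits_less) auto

text \<open>
  Ranging both indices over the same set makes it easy to exchange, reflect and combine the sums.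
\<close>

lemma double_sum_alt:
  "double_sum e f = (\<Sum>j\<in>{1..<p}. \<Sum>i\<in>{1..<p}. if i < j then of_nat i powi e * of_nat j powi f else 0)"
  unfolding double_sum_def
  by (intro sum.cong refl sum.mono_neutral_cong_left) auto

text \<open>
  By Fermat's theorem the inner sum may be taken with the positive exponent \<open>p - 1 - b\<close>, so Faulhaber's
  formula turns it into a polynomial in \<open>j\<close>. Summing over \<open>j\<close> then leaves only those monomials whose
  total exponent is divisible by \<open>p - 1\<close>. The bounds on \<open>b\<close> and \<open>c\<close> keep the exponents strictly between
  \<open>- (p - 1)\<close> and \<open>p - 1\<close>, so only exponent zero survives, that is \<open>k = p - b - c\<close>.
\<close>

lemma double_sum_pcong_bernoulli:
  assumes bc: "0 < b" "0 < c" "b + c < p"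
  shows "of_nat b * double_sum (- int b) (- int c) \<approx>\<^bsub>1\<^esub>
    (- 1) ^ c * of_nat ((b + c - 1) choose c) * bernoulli (p - b - c)"
proof -
  define n where "n = p - 1 - b"
  have n: "0 < n" "Suc n = p - b" using bc by (auto simp: n_def)
  have inner: "of_nat (p - b) * (\<Sum>i\<in>{1..<j}. of_nat i ^ n) =
      (\<Sum>k\<le>n. of_nat ((p - b) choose k) * bernoulli k * of_nat j ^ (p - b - k))" for j
  proof -
    have "(\<Sum>i\<in>{1..<j}. of_nat i ^ n) = (\<Sum>i<j. of_nat i ^ n :: rat)"
      using n by (intro sum.mono_neutral_left) auto
    thus ?thesis using faulhaber[of n j] by (simp only: n)
  qed
  have "double_sum (- int b) (- int c) \<approx>\<^bsub>1\<^esub>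
      (\<Sum>j\<in>{1..<p}. of_nat j powi (- int c) * (\<Sum>i\<in>{1..<j}. of_nat i ^ n))"
    unfolding double_sum_def sum_distrib_left
  proof (intro pcong_sum)
    fix i j assume j: "j \<in> {1..<p}" and i: "i \<in> {1..<j}"
    have "- int b - int n = - int (p - 1)" using bc by (simp add: n_def)
    hence "int (p - 1) dvd - int b - int n" by (simp only: dvd_minus_iff dvd_refl)
    hence "of_nat i powi (- int b) \<approx>\<^bsub>1\<^esub> of_nat i powi (int n)"
      using i j by (intro powi_exponent_pcong) (auto dest: dvd_imp_le)
    thus "of_nat i powi (- int b) * of_nat j powi (- int c) \<approx>\<^bsub>1\<^esub> of_nat j powi (- int c) * of_nat i ^ n"
      using j by (subst mult.commute, intro pcong_mult_left)
        (simp_all only: power_int_of_nat, intro Zunits_Zloc Zunits_powi Zunits_less, auto)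
  qed
  hence "of_nat (p - b) * double_sum (- int b) (- int c) \<approx>\<^bsub>1\<^esub>
      of_nat (p - b) * (\<Sum>j\<in>{1..<p}. of_nat j powi (- int c) * (\<Sum>i\<in>{1..<j}. of_nat i ^ n))"
    by (intro pcong_mult_left) auto
  also have "\<dots> = (\<Sum>j\<in>{1..<p}. of_nat j powi (- int c) *
      (\<Sum>k\<le>n. of_nat ((p - b) choose k) * bernoulli k * of_nat j ^ (p - b - k)))"
    by (subst sum_distrib_left, intro sum.cong refl)
       (simp only: mult.left_commute[of "of_nat (p - b)"] inner)
  also have "\<dots> = (\<Sum>k\<le>n. of_nat ((p - b) choose k) * bernoulli k *
      power_sum (int (p - b - k) - int c))"
    unfolding power_sum_def sum_distrib_left
    by (subst sum.swap, intro sum.cong refl)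
       (simp_all add: power_int_diff power_int_minus field_simps)
  also have "\<dots> \<approx>\<^bsub>1\<^esub> (\<Sum>k\<le>n. of_nat ((p - b) choose k) * bernoulli k *
      (if k = p - b - c then - 1 else 0))"
  proof (intro pcong_sum pcong_mult_left)
    fix k assume k: "k \<in> {..n}"
    show "of_nat ((p - b) choose k) * bernoulli k \<in> Zloc"
      using k n bc by (intro Zloc_mult bernoulli_Zloc) auto
    show "power_sum (int (p - b - k) - int c) \<approx>\<^bsub>1\<^esub> (if k = p - b - c then - 1 else 0)"
    proof (cases "k = p - b - c")
      case True
      with bc show ?thesis using power_sum_pcong_minus_1[of 0] by simp
    next
      case False
      define d where "d = int (p - b - k) - int c"
      have "d \<noteq> 0" "\<bar>d\<bar> < int (p - 1)" using False k n bc by (auto simp: d_def)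
      hence "\<not> int (p - 1) dvd d" by (auto dest: dvd_imp_le_int)
      with False show ?thesis using power_sum_pcong_0[of d] by (simp add: d_def)
    qed
  qed
  also have "\<dots> = - (of_nat ((p - b) choose c) * bernoulli (p - b - c))"
    using bc n binomial_symmetric[of c "p - b"] by (simp add: if_distrib[of "\<lambda>x. _ * x"] cong: if_cong)
  finally have "of_nat (p - b) * double_sum (- int b) (- int c) \<approx>\<^bsub>1\<^esub>
      - (of_nat ((p - b) choose c) * bernoulli (p - b - c))" .
  moreover have "of_nat p * double_sum (- int b) (- int c) \<approx>\<^bsub>1\<^esub> 0" by (intro pcong_p) simp
  ultimately have "of_nat p * double_sum (- int b) (- int c) - of_nat (p - b) * double_sum (- int b) (- int c)
      \<approx>\<^bsub>1\<^esub> 0 - - (of_nat ((p - b) choose c) * bernoulli (p - b - c))"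
    by (intro pcong_diff)
  hence "of_nat b * double_sum (- int b) (- int c) \<approx>\<^bsub>1\<^esub> of_nat ((p - b) choose c) * bernoulli (p - b - c)"
    using bc by (simp add: of_nat_diff algebra_simps)
  also have "\<dots> \<approx>\<^bsub>1\<^esub> (- 1) ^ c * of_nat ((b + c - 1) choose c) * bernoulli (p - b - c)"
    using bc by (intro pcong_mult binomial_p_minus_pcong pcong_refl bernoulli_Zloc)
      (auto intro!: Zloc_mult Zloc_power Zloc_uminus simp del: binomial_Suc_Suc)
  finally show ?thesis .
qed

lemma double_sum_stuffle:
  "double_sum e f + double_sum f e + power_sum (e + f) = power_sum e * power_sum f"
proof -
  let ?t = "\<lambda>i j. of_nat i powi e * of_nat j powi f :: rat"
  have "double_sum f e = (\<Sum>j\<in>{1..<p}. \<Sum>i\<in>{1..<p}. if j < i then ?t i j else 0)"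
    unfolding double_sum_alt by (subst sum.swap, intro sum.cong refl) (simp add: mult.commute)
  moreover have "power_sum (e + f) = (\<Sum>j\<in>{1..<p}. \<Sum>i\<in>{1..<p}. if i = j then ?t i j else 0)"
    unfolding power_sum_def by (intro sum.cong refl) (auto simp: power_int_add)
  ultimately have "double_sum e f + double_sum f e + power_sum (e + f) =
    (\<Sum>j\<in>{1..<p}. \<Sum>i\<in>{1..<p}. (if i < j then ?t i j else 0) + (if j < i then ?t i j else 0) +
      (if i = j then ?t i j else 0))"
    by (simp only: double_sum_alt[of e f] sum.distrib)
  also have "\<dots> = (\<Sum>j\<in>{1..<p}. \<Sum>i\<in>{1..<p}. ?t i j)" by (intro sum.cong refl) auto
  also have "\<dots> = power_sum e * power_sum f"
    unfolding power_sum_def by (subst sum.swap) (simp only: sum_product)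
  finally show ?thesis .
qed

text \<open>
  Replacing \<open>i\<close> and \<open>j\<close> by \<open>p - i\<close> and \<open>p - j\<close> reverses the condition \<open>i < j\<close>. For an even exponent the
  sign of \<open>- i\<close> disappears in the leading term of the Taylor expansion of \<open>(p - i)\<^sup>e\<close>, and is \<open>- 1\<close>
  in the linear term.
\<close>

lemma double_sum_reflect:
  assumes "even e" "even f"
  shows "double_sum e f \<approx>\<^bsub>2\<^esub> double_sum f e -
    of_nat p * (of_int e * double_sum f (e - 1) + of_int f * double_sum (f - 1) e)"
proof -
  have taylor: "of_nat (p - i) powi k \<approx>\<^bsub>2\<^esub> of_nat i powi k - of_nat p * (of_int k * of_nat i powi (k - 1))"
    if "i \<in> {1..<p}" "even k" for i k
  proof -
    have u: "of_nat i \<in> Zunits" "of_nat (p - i) \<in> Zunits" using that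
      by (auto intro!: Zunits_less simp del: of_nat_diff)
    hence m: "- of_nat i \<in> Zunits" using that by (intro ZunitsI) auto
    have "of_nat (p - i) powi k \<approx>\<^bsub>2\<^esub>
        (- of_nat i) powi k + of_int k * (of_nat p * 1) * (- of_nat i) powi (k - 1)"
      using that by (intro powi_taylor u m) (auto simp: of_nat_diff)
    thus ?thesis using \<open>even k\<close> by (simp add: power_int_minus_left algebra_simps)
  qed
  let ?t = "\<lambda>i j. of_nat (p - i) powi e * of_nat (p - j) powi f :: rat"
  let ?u = "\<lambda>i j. of_nat j powi f * of_nat i powi e -
      of_nat p * (of_int e * (of_nat j powi f * of_nat i powi (e - 1)) +
                  of_int f * (of_nat j powi (f - 1) * of_nat i powi e)) :: rat"
  have "double_sum e f = (\<Sum>j\<in>{1..<p}. \<Sum>i\<in>{1..<p}. if p - i < p - j then ?t i j else 0)"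
    unfolding double_sum_alt by (subst sum.atLeastLessThan_rev, subst (2) sum.atLeastLessThan_rev)
      (simp cong: if_cong)
  also have "\<dots> = (\<Sum>j\<in>{1..<p}. \<Sum>i\<in>{1..<p}. if j < i then ?t i j else 0)"
    by (intro sum.cong refl) auto
  also have "\<dots> = (\<Sum>i\<in>{1..<p}. \<Sum>j\<in>{1..<p}. if j < i then ?t i j else 0)"
    by (rule sum.swap)
  also have "\<dots> = (\<Sum>i\<in>{1..<p}. \<Sum>j\<in>{1..<i}. ?t i j)"
    by (intro sum.cong refl sum.mono_neutral_cong_right) auto
  also have "\<dots> \<approx>\<^bsub>2\<^esub> (\<Sum>i\<in>{1..<p}. \<Sum>j\<in>{1..<i}. ?u i j)"
  proof (intro pcong_sum)
    fix i j assume i: "i \<in> {1..<p}" and "j \<in> {1..<i}"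
    hence j: "j \<in> {1..<p}" by auto
    have Z: "of_nat k powi n \<in> Zloc" if "k \<in> {1..<p}" for k n
      using that by (intro Zunits_Zloc Zunits_powi Zunits_less) auto
    let ?a = "of_int e * of_nat i powi (e - 1) :: rat" and ?b = "of_int f * of_nat j powi (f - 1) :: rat"
    have "?t i j \<approx>\<^bsub>2\<^esub> (of_nat i powi e - of_nat p * ?a) * (of_nat j powi f - of_nat p * ?b)"
      using i j assms by (intro pcong_mult taylor) (auto intro!: Zloc_mult Zloc_diff Z simp del: of_nat_diff)
    also have "\<dots> = ?u i j + of_nat p ^ 2 * (?a * ?b)" by (simp add: algebra_simps power2_eq_square)
    also have "\<dots> \<approx>\<^bsub>2\<^esub> ?u i j + 0" using i j
      by (intro pcong_add pcong_p_power pcong_refl Zloc_mult Z) auto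
    finally show "?t i j \<approx>\<^bsub>2\<^esub> ?u i j" by simp
  qed
  also have "\<dots> = double_sum f e -
    of_nat p * (of_int e * double_sum f (e - 1) + of_int f * double_sum (f - 1) e)"
    unfolding double_sum_def by (simp only: sum_subtractf distrib_left sum.distrib sum_distrib_left)
  finally show ?thesis .
qed

end

section \<open>Evaluation of the sum\<close>

text \<open>
  With partial sums \<open>A\<^sub>j\<close>, this is the telescoping of
  \<open>A\<^sub>j\<^sup>3 - A\<^bsub>j-1\<^esub>\<^sup>3 = 3 A\<^sub>j\<^sup>2 a\<^sub>j - 3 A\<^sub>j a\<^sub>j\<^sup>2 + a\<^sub>j\<^sup>3\<close>, after splitting \<open>A\<^sub>j = A\<^bsub>j-1\<^esub> + a\<^sub>j\<close> in the
  middle term.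
\<close>

lemma sum_partial_sums_squared_mult:
  fixes a :: "nat \<Rightarrow> 'a :: comm_ring_1"
  shows "3 * (\<Sum>j=1..n. (\<Sum>k=1..j. a k)\<^sup>2 * a j) =
    3 * (\<Sum>j=1..n. \<Sum>i\<in>{1..<j}. a i * (a j)\<^sup>2) + 2 * (\<Sum>j=1..n. a j ^ 3) + (\<Sum>k=1..n. a k) ^ 3"
proof (induction n)
  case (Suc n)
  have "{1..<Suc n} = {1..n}" by auto
  hence "(\<Sum>i\<in>{1..<Suc n}. a i * (a (Suc n))\<^sup>2) = (\<Sum>k=1..n. a k) * (a (Suc n))\<^sup>2"
    by (simp only: sum_distrib_right)
  with Suc.IH show ?case by (simp add: power2_eq_square power3_eq_cube algebra_simps)
qed auto

text \<open>
  This matches the coefficients coming from the two odd-weight double sums with the binomial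
  coefficient of the closed form. All three binomials are polynomial multiples of
  \<open>X = (3s)! / ((s+1)! (2s+2)!)\<close>.
\<close>

lemma binomial_combination:
  assumes "s > 0"
  shows "(of_nat (3 * s + 1) :: rat) * (4 * of_nat s * of_nat (3 * s choose s)
       - of_nat (2 * s + 1) * of_nat (3 * s choose (s + 1))) =
     4 * of_nat (2 * s + 1) * of_nat ((3 * s + 1) choose (s - 1))"
proof -
  define u v w where "u = (of_nat (s + 1) :: rat)" and "v = (of_nat (2 * s + 1) :: rat)"
    and "w = (of_nat (2 * s + 2) :: rat)"
  have nz: "u \<noteq> 0" "v \<noteq> 0" "w \<noteq> 0" "(of_nat s :: rat) \<noteq> 0"
    unfolding u_def v_def w_def of_nat_eq_0_iff using assms by simp_all
  obtain t where s: "s = Suc t" using assms by (cases s) auto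
  define X :: rat where "X = fact (3 * s) / (u * fact s * (w * v * fact (2 * s)))"
  have f: "fact (s + 1) = u * (fact s :: rat)" "fact (2 * s + 2) = w * v * (fact (2 * s) :: rat)"
    "fact (3 * s + 1) = of_nat (3 * s + 1) * (fact (3 * s) :: rat)"
    by (simp_all add: u_def v_def w_def algebra_simps)
  have "fact (2 * s) = of_nat (2 * s) * (fact (2 * s - 1) :: rat)" "fact s = of_nat s * (fact (s - 1) :: rat)"
    using assms by (simp_all add: fact_reduce)
  hence f': "fact (2 * s - 1) = fact (2 * s) / (of_nat (2 * s) :: rat)"
    "fact (s - 1) = fact s / (of_nat s :: rat)"
    using assms by simp_all
  have "(of_nat (3 * s choose s) :: rat) = fact (3 * s) / (fact s * fact (2 * s))"
    using binomial_fact[of s "3 * s"] by simp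
  hence 1: "(of_nat (3 * s choose s) :: rat) = X * (u * v * w)"
    using nz by (simp add: X_def)
  have "3 * s - (s + 1) = 2 * s - 1" by simp
  hence "(of_nat (3 * s choose (s + 1)) :: rat) = fact (3 * s) / (fact (s + 1) * fact (2 * s - 1))"
    using binomial_fact[of "s + 1" "3 * s"] assms by simp
  hence 2: "(of_nat (3 * s choose (s + 1)) :: rat) = X * (2 * of_nat s * v * w)"
    unfolding f f' using nz by (simp add: X_def)
  have "3 * s + 1 - (s - 1) = 2 * s + 2" using s by simp
  hence "(of_nat ((3 * s + 1) choose (s - 1)) :: rat) = fact (3 * s + 1) / (fact (s - 1) * fact (2 * s + 2))"
    using binomial_fact[of "s - 1" "3 * s + 1", where 'a = rat] by simp
  hence 3: "(of_nat ((3 * s + 1) choose (s - 1)) :: rat) = X * (of_nat (3 * s + 1) * of_nat s * u)"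
    unfolding f f' using nz by (simp add: X_def mult_ac)
  have "w = 2 * u" "v = 2 * u - 1" "of_nat s = u - 1" by (simp_all add: u_def v_def w_def)
  thus ?thesis unfolding 1 2 3 v_def[symmetric] by (simp only:) (simp add: algebra_simps)
qed

theorem corollary2p3p2:
  fixes s p :: nat
  assumes "s > 0" and "even s" and "prime p" and "p > 3 * s + 1"
  shows "rat_cong
    (\<Sum>j=1..p - 1. (gen_harmonic s j)\<^sup>2 / of_nat j ^ s)
    ((of_nat ((3 * s + 1) choose (s - 1)) + of_nat s / 2) * of_nat p *
       (bernoulli (p - 3 * s - 1) / of_nat (3 * s + 1)))
    (p\<^sup>2)"
proof -
  interpret prime_localization p by unfold_locales (rule assms)
  define B where "B = bernoulli (p - 3 * s - 1)"
  define S where "S = (\<Sum>j=1..p - 1. (gen_harmonic s j)\<^sup>2 / of_nat j ^ s)"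
  define T where "T = (of_nat ((3 * s + 1) choose (s - 1)) + of_nat s / 2) * of_nat p *
       (B / of_nat (3 * s + 1))"
  define P1 P2 P3 where "P1 = power_sum (- int s)" and "P2 = power_sum (- int (2 * s))"
    and "P3 = power_sum (- int (3 * s))"
  define D where "D = double_sum (- int s) (- int (2 * s))"
  define D' where "D' = double_sum (- int (2 * s)) (- int s)"
  define E1 where "E1 = double_sum (- int (2 * s)) (- int (s + 1))"
  define E2 where "E2 = double_sum (- int (2 * s + 1)) (- int s)"
  have Z [simp]: "P1 \<in> Zloc" "P2 \<in> Zloc" "P3 \<in> Zloc" "D \<in> Zloc" "D' \<in> Zloc" "E1 \<in> Zloc" "E2 \<in> Zloc"
    by (simp_all only: P1_def P2_def P3_def D_def D'_def E1_def E2_def double_sum_Zloc power_sum_Zloc)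
  have B [simp]: "B \<in> Zloc" unfolding B_def using assms by (intro bernoulli_Zloc) auto
  have "p > 7" using assms by (cases "s = 1") auto
  have u2: "2 \<in> Zunits" using Zunits_less[of 2] \<open>p > 7\<close> by simp
  have u: "of_nat (3 * s + 1) \<in> Zunits" "of_nat (2 * s + 1) \<in> Zunits"
    using assms by (intro Zunits_less; simp)+
  have u12: "12 \<in> Zunits"
  proof -
    have "of_nat 2 * of_nat 6 \<in> Zunits" using \<open>p > 7\<close> by (intro Zunits_mult Zunits_less) auto
    thus ?thesis by simp
  qed
  have small: "power_sum (- int k) \<approx>\<^bsub>1\<^esub> 0" if "0 < k" "k + 1 < p" for k
    using that by (intro power_sum_pcong_0)
      (simp only: dvd_minus_iff int_dvd_int_iff, auto dest: dvd_imp_le)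
  have P1: "P1 \<approx>\<^bsub>1\<^esub> 0" and P2: "P2 \<approx>\<^bsub>1\<^esub> 0"
    unfolding P1_def P2_def using assms small[of s] small[of "2 * s"] by simp_all

  have S3: "3 * S = 3 * D + 2 * P3 + P1 ^ 3"
  proof -
    define a where "a k = (of_nat k powi (- int s) :: rat)" for k :: nat
    have I: "{1..p - 1} = {1..<p}" using prime_gt_0_nat[OF prime_p] by auto
    have a2: "(a j)\<^sup>2 = of_nat j powi (- int (2 * s))" for j
      unfolding a_def power_int_power' by (simp add: mult.commute)
    have a3: "a j ^ 3 = of_nat j powi (- int (3 * s))" for j
      unfolding a_def power_int_power' by (simp add: mult.commute)
    have "S = (\<Sum>j=1..p - 1. (\<Sum>k=1..j. a k)\<^sup>2 * a j)"
      unfolding S_def a_def gen_harmonic_def by (simp add: power_int_minus divide_inverse)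
    hence "3 * S = 3 * (\<Sum>j=1..p - 1. \<Sum>i\<in>{1..<j}. a i * (a j)\<^sup>2) +
        2 * (\<Sum>j=1..p - 1. a j ^ 3) + (\<Sum>k=1..p - 1. a k) ^ 3"
      by (simp only: sum_partial_sums_squared_mult)
    thus ?thesis unfolding I a2 a3
      by (simp only: D_def P3_def P1_def double_sum_def power_sum_def a_def)
  qed
  have "P1 ^ 3 \<approx>\<^bsub>2\<^esub> 0"
  proof -
    have "P1 * (P1 * P1) \<approx>\<^bsub>2\<^esub> P1 * 0"
      using pcong_mult_zeros[OF P1 P1] by (intro pcong_mult_left) (simp_all only: one_add_one Z)
    thus ?thesis by (simp add: power3_eq_cube mult.assoc)
  qed
  have stuffle: "D + D' + P3 \<approx>\<^bsub>2\<^esub> 0"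
  proof -
    have "D + D' + P3 = P1 * P2"
      using double_sum_stuffle[of "- int s" "- int (2 * s)"]
      by (simp add: D_def D'_def P1_def P2_def P3_def)
    thus ?thesis using pcong_mult_zeros[OF P1 P2] by (simp only: one_add_one)
  qed
  have refl: "D \<approx>\<^bsub>2\<^esub> D' + of_nat p * (of_nat s * (E1 + 2 * E2))"
  proof -
    have shift: "- int s - 1 = - int (s + 1)" "- int (2 * s) - 1 = - int (2 * s + 1)" by auto
    have "even (- int s)" "even (- int (2 * s))" using \<open>even s\<close> by simp_all
    from double_sum_reflect[OF this] have
      "D \<approx>\<^bsub>2\<^esub> D' - of_nat p * (of_int (- int s) * E1 + of_int (- int (2 * s)) * E2)"
      by (simp only: shift D_def D'_def E1_def E2_def)
    thus ?thesis by (simp add: algebra_simps)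
  qed
  have E1: "2 * of_nat s * E1 \<approx>\<^bsub>1\<^esub> - of_nat (3 * s choose (s + 1)) * B"
  proof -
    have "p - 2 * s - (s + 1) = p - 3 * s - 1" "2 * s + (s + 1) - 1 = 3 * s" by auto
    thus ?thesis
      using double_sum_pcong_bernoulli[of "2 * s" "s + 1"] assms by (simp add: E1_def B_def)
  qed
  have E2: "of_nat (2 * s + 1) * E2 \<approx>\<^bsub>1\<^esub> of_nat (3 * s choose s) * B"
  proof -
    have "p - (2 * s + 1) - s = p - 3 * s - 1" "2 * s + 1 + s - 1 = 3 * s" by auto
    thus ?thesis
      using double_sum_pcong_bernoulli[of "2 * s + 1" s] assms by (simp add: E2_def B_def)
  qed
  have P3: "of_nat (3 * s + 1) * P3 \<approx>\<^bsub>2\<^esub> of_nat (3 * s) * (of_nat p * B)"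
  proof -
    have "p - 1 - 3 * s = p - 3 * s - 1" by auto
    thus ?thesis using power_sum_neg[of "3 * s"] assms by (simp add: P3_def B_def)
  qed

  \<comment> \<open>Stuffle and reflection give \<open>2 D\<close>, hence the factor 6.\<close>
  have "6 * S = P3 + (3 * (D - D') + (3 * (D + D' + P3) + 2 * P1 ^ 3))"
    using S3 by simp
  also have "\<dots> \<approx>\<^bsub>2\<^esub> P3 + (3 * (D' + of_nat p * (of_nat s * (E1 + 2 * E2)) - D') + (3 * 0 + 2 * 0))"
    by (intro pcong_add pcong_mult_left pcong_diff pcong_refl refl stuffle \<open>P1 ^ 3 \<approx>\<^bsub>2\<^esub> 0\<close>) auto
  finally have S6: "6 * S \<approx>\<^bsub>2\<^esub> P3 + 3 * (of_nat p * (of_nat s * (E1 + 2 * E2)))" by simp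

  \<comment> \<open>The factor \<open>12 (3s + 1) (2s + 1)\<close>, a unit, clears the denominators of all evaluations at once.\<close>
  let ?c = "of_nat (3 * s + 1) * of_nat (2 * s + 1) :: rat"
  have "12 * ?c * S = 2 * ?c * (6 * S)" by simp
  also have "\<dots> \<approx>\<^bsub>2\<^esub> 2 * ?c * (P3 + 3 * (of_nat p * (of_nat s * (E1 + 2 * E2))))"
    by (intro pcong_mult_left S6 Zloc_mult) auto
  also have "\<dots> = 2 * of_nat (2 * s + 1) * (of_nat (3 * s + 1) * P3) + 3 * of_nat (3 * s + 1) *
      (of_nat p * (of_nat (2 * s + 1) * (2 * of_nat s * E1) + 4 * of_nat s * (of_nat (2 * s + 1) * E2)))"
    by (simp add: algebra_simps)
  also have "\<dots> \<approx>\<^bsub>2\<^esub> 2 * of_nat (2 * s + 1) * (of_nat (3 * s) * (of_nat p * B)) +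
      3 * of_nat (3 * s + 1) * (of_nat p * (of_nat (2 * s + 1) * (- of_nat (3 * s choose (s + 1)) * B) +
        4 * of_nat s * (of_nat (3 * s choose s) * B)))"
    by (intro pcong_add pcong_mult_left pcong_lift P3 E1 E2) (simp_all del: of_nat_add of_nat_mult of_nat_Suc)
  also have "\<dots> = 6 * of_nat s * of_nat (2 * s + 1) * of_nat p * B + 3 * of_nat p * B *
      (of_nat (3 * s + 1) * (4 * of_nat s * of_nat (3 * s choose s)
       - of_nat (2 * s + 1) * of_nat (3 * s choose (s + 1))))"
    by (simp add: algebra_simps)
  also have "\<dots> = 12 * ?c * T"
    unfolding binomial_combination[OF \<open>s > 0\<close>] T_def
    using Zunits_nonzero[OF u(1)] by (simp add: field_simps del: binomial_Suc_Suc)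
  finally have "S \<approx>\<^bsub>2\<^esub> T"
    using u u12 by (rule_tac pcong_cancel[of "12 * ?c"]) (auto intro!: Zunits_mult simp del: of_nat_add)
  then obtain z where z: "z \<in> Zloc" "S - T = of_nat p ^ 2 * z" unfolding pcong_def by blast
  have T: "T \<in> Zloc" unfolding T_def using u u2 by (intro Zloc_mult Zloc_add Zloc_divide) auto
  have "S = T + of_nat p ^ 2 * z" using z(2) by simp
  hence S: "S \<in> Zloc" using T z(1) by simp
  have dc: "denom_coprime (p\<^sup>2) x \<longleftrightarrow> x \<in> Zloc" for x
    by (simp add: denom_coprime_def Zloc_def)
  have "rat_cong S T (p\<^sup>2)" unfolding rat_cong_def dc using S T z by auto
  thus ?thesis by (simp only: S_def T_def B_def)
qed

end
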